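(* Let $n\geq 2$ be an integer. Suppose there are a positive integer $r$ and a prime $p$ such that $p$ divides $2r-1$ and $pr$ divides $n$. Then the Weyl groupoid associated to the braiding on $\mathcal{B}_{C_n}$ is not defined.
   Context: Let $k$ be a field of characteristic zero containing a primitive $n$-th root of unity $\xi$, and let $C_n$ be the cyclic group of order $n$ with generator $g$. Let $Y_{C_n}$ be the Yetter--Drinfeld module over $kC_n$ with basis $s_1,\ldots,s_{n-1}$, action $g\cdot s_i=\xi s_i$ and coaction (grading) $\delta(s_i)=g^i\otimes s_i$. Its braiding is $\Psi(s_i\otimes s_j)=\xi^i s_j\otimes s_i$, i.e. it is of diagonal type with matrix $q_{ij}=\xi^i$, $1\leq i,j\leq n-1$. $\mathcal{B}_{C_n}:=\mathcal{B}(Y_{C_n})$ denotes the Nichols algebra of $Y_{C_n}$. Reflections and Weyl groupoid: let $(q_{ij})_{i,j\in I}$ be a matrix of roots of unity, and suppose $q_{ii}\neq 1$ for all $i$. For $i\neq j$ put $$-a_{ij}=\min\{m\in\mathbb{N}_0\mid (m+1)_{q_{ii}}(q_{ii}^mq_{ij}q_{ji}-1)=0\},\qquad (m+1)_q=1+q+\cdots+q^m,$$ and $a_{ii}=2$. Let $\chi$ be the bicharacter on $\mathbb{Z}^I$ with $\chi(e_i,e_j)=q_{ij}$ on the standard basis, and let $\sigma_i$ be the linear map with $\sigma_i(e_j)=e_j-a_{ij}e_i$ for all $j\in I$ (in particular $\sigma_i(e_i)=-e_i$). The reflection of $(q_{ij})$ at the vertex $i$ is the matrix $(q'_{jl})_{j,l\in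 I}$ with $q'_{jl}=\chi(\sigma_i(e_j),\sigma_i(e_l))$. The Weyl groupoid associated to $(q_{ij})$ is said to be defined if these reflections can be iterated indefinitely at arbitrary vertices, i.e. if every matrix obtained from $(q_{ij})$ by a finite sequence of reflections has all diagonal entries different from $1$; it is not defined if some finite sequence of reflections produces a matrix with a diagonal entry $q'_{ii}=1$. *)

theory Defs
  imports "HOL-Computational_Algebra.Primes"
begin

definition primitive_root_of_unity :: "nat \<Rightarrow> 'k::field \<Rightarrow> bool" where
  "primitive_root_of_unity n \<xi> \<longleftrightarrow>
     0 < n \<and> \<xi> ^ n = 1 \<and> (\<forall>m. 0 < m \<and> m < n \<longrightarrow> \<xi> ^ m \<noteq> 1)"


section \<open>The Yetter--Drinfeld module of the cyclic group and its braiding\<close>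

text \<open>
  A vector of the module with basis \<open>s\<^sub>i\<close> (\<open>1 \<le> i < n\<close>) is given by its coordinate function
  and an element of the tensor square by its coordinate function on pairs of indices.
  The group element \<open>g\<^sup>d\<close> of \<open>C\<^sub>n\<close> is represented by its exponent \<open>d\<close>, \<open>0 \<le> d < n\<close>.
\<close>

definition basis_vec :: "'i \<Rightarrow> 'i \<Rightarrow> 'k::field" where
  "basis_vec i = (\<lambda>j. if j = i then 1 else 0)"

definition tensor :: "('i \<Rightarrow> 'k::field) \<Rightarrow> ('i \<Rightarrow> 'k) \<Rightarrow> 'i \<times> 'i \<Rightarrow> 'k" where
  "tensor v w = (\<lambda>(a, b). v a * w b)"

text \<open>The action of the generator, \<open>g \<cdot> s\<^sub>j = \<xi> s\<^sub>j\<close>.\<close>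

definition gen_action :: "'k::field \<Rightarrow> (nat \<Rightarrow> 'k) \<Rightarrow> nat \<Rightarrow> 'k" where
  "gen_action \<xi> v = (\<lambda>j. \<xi> * v j)"

text \<open>
  The coaction as a grading: \<open>s\<^sub>i\<close> is homogeneous of degree \<open>g\<^sup>i\<close>, so the homogeneous component
  of degree \<open>g\<^sup>d\<close> of a vector is its \<open>s\<^sub>d\<close>-part (zero for \<open>d = 0\<close>).
\<close>

definition hom_component :: "nat \<Rightarrow> nat \<Rightarrow> (nat \<Rightarrow> 'k::field) \<Rightarrow> nat \<Rightarrow> 'k" where
  "hom_component n d v = (\<lambda>i. if i \<in> {1..<n} \<and> i = d then v i else 0)"

text \<open>
  The Yetter--Drinfeld braiding \<open>\<Psi>(v \<otimes> w) = v\<^sub>(\<^sub>-\<^sub>1\<^sub>) \<cdot> w \<otimes> v\<^sub>(\<^sub>0\<^sub>)\<close>, that is, the sum of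
  \<open>(g\<^sup>d \<cdot> w) \<otimes> v\<^sub>d\<close> over the group elements \<open>g\<^sup>d\<close>, where \<open>v\<^sub>d\<close> is the component of degree \<open>g\<^sup>d\<close>.
\<close>

definition cyclic_braiding ::
    "nat \<Rightarrow> 'k::field \<Rightarrow> (nat \<Rightarrow> 'k) \<Rightarrow> (nat \<Rightarrow> 'k) \<Rightarrow> nat \<times> nat \<Rightarrow> 'k" where
  "cyclic_braiding n \<xi> v w =
     (\<lambda>ab. \<Sum>d<n. tensor ((gen_action \<xi> ^^ d) w) (hom_component n d v) ab)"

text \<open>\<open>\<Psi>(s\<^sub>i \<otimes> s\<^sub>j) = q\<^sub>i\<^sub>j s\<^sub>j \<otimes> s\<^sub>i\<close> for all \<open>i, j \<in> I\<close>.\<close>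

definition diagonal_type ::
    "'i set \<Rightarrow> (('i \<Rightarrow> 'k::field) \<Rightarrow> ('i \<Rightarrow> 'k) \<Rightarrow> 'i \<times> 'i \<Rightarrow> 'k) \<Rightarrow> ('i \<Rightarrow> 'i \<Rightarrow> 'k) \<Rightarrow> bool" where
  "diagonal_type I \<Psi> q \<longleftrightarrow>
     (\<forall>i\<in>I. \<forall>j\<in>I. \<Psi> (basis_vec i) (basis_vec j) =
        (\<lambda>ab. q i j * tensor (basis_vec j) (basis_vec i) ab))"

lemma gen_action_funpow: "(gen_action \<xi> ^^ d) w = (\<lambda>j. \<xi> ^ d * w j)"
  by (induction d) (auto simp: gen_action_def mult.assoc)

lemma cyclic_braiding_basis:
  assumes "i \<in> {1..<n}"
  shows "cyclic_braiding n \<xi> (basis_vec i) (basis_vec j) =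
           (\<lambda>ab. \<xi> ^ i * tensor (basis_vec j) (basis_vec i) ab)"
proof
  fix ab :: "nat \<times> nat"
  obtain a b where ab: "ab = (a, b)" by (cases ab)
  have "cyclic_braiding n \<xi> (basis_vec i) (basis_vec j) ab =
          (\<Sum>d<n. if d = i then \<xi> ^ i * tensor (basis_vec j) (basis_vec i) ab else 0)"
    unfolding cyclic_braiding_def using assms
    by (intro sum.cong)
       (auto simp: ab tensor_def gen_action_funpow hom_component_def basis_vec_def)
  then show "cyclic_braiding n \<xi> (basis_vec i) (basis_vec j) ab =
      \<xi> ^ i * tensor (basis_vec j) (basis_vec i) ab"
    using assms by simp
qed

lemma diagonal_type_cyclic_braiding_iff:
  "diagonal_type {1..<n} (cyclic_braiding n \<xi>) q \<longleftrightarrow>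
     (\<forall>i\<in>{1..<n}. \<forall>j\<in>{1..<n}. q i j = \<xi> ^ i)"
proof -
  have "(\<lambda>ab. \<xi> ^ i * tensor (basis_vec j) (basis_vec i) ab) =
          (\<lambda>ab. q i j * tensor (basis_vec j) (basis_vec i) ab) \<longleftrightarrow> q i j = \<xi> ^ i" for i j
    by (auto simp: fun_eq_iff tensor_def basis_vec_def)
  then show ?thesis
    unfolding diagonal_type_def by (simp add: cyclic_braiding_basis)
qed


section \<open>Reflections and the Weyl groupoid\<close>

text \<open>
  The index set \<open>I\<close> is finite. Matrices are functions of which only the entries with indices
  in \<open>I\<close> matter, and elements of \<open>\<int>\<^sup>I\<close> are functions of which only the values on \<open>I\<close> matter.
\<close>

text \<open>The \<open>q\<close>-integer \<open>(m)\<^sub>q = 1 + q + \<dots> + q\<^sup>m\<^sup>-\<^sup>1\<close>.\<close>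

definition q_int :: "nat \<Rightarrow> 'k::field \<Rightarrow> 'k" where
  "q_int m q = (\<Sum>l<m. q ^ l)"

text \<open>
  The minimum exists whenever \<open>q i i\<close> is a root of unity different from \<open>1\<close>;
  below, the entries are only used in that case.
\<close>

definition cartan_entry :: "('i \<Rightarrow> 'i \<Rightarrow> 'k::field) \<Rightarrow> 'i \<Rightarrow> 'i \<Rightarrow> int" where
  "cartan_entry q i j =
     (if i = j then 2
      else - int (LEAST m. q_int (m + 1) (q i i) * (q i i ^ m * q i j * q j i - 1) = 0))"

definition unit_vec :: "'i \<Rightarrow> 'i \<Rightarrow> int" where
  "unit_vec i = (\<lambda>j. if j = i then 1 else 0)"

definition bichar :: "'i set \<Rightarrow> ('i \<Rightarrow> 'i \<Rightarrow> 'k::field) \<Rightarrow> ('i \<Rightarrow> int) \<Rightarrow> ('i \<Rightarrow> int) \<Rightarrow> 'k" where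
  "bichar I q \<alpha> \<beta> = (\<Prod>i\<in>I. \<Prod>j\<in>I. q i j powi (\<alpha> i * \<beta> j))"

text \<open>The linear map with \<open>\<sigma>\<^sub>i(e\<^sub>j) = e\<^sub>j - a\<^sub>i\<^sub>j e\<^sub>i\<close> for all \<open>j \<in> I\<close>.\<close>

definition refl_map :: "'i set \<Rightarrow> ('i \<Rightarrow> 'i \<Rightarrow> 'k::field) \<Rightarrow> 'i \<Rightarrow> ('i \<Rightarrow> int) \<Rightarrow> 'i \<Rightarrow> int" where
  "refl_map I q i \<alpha> = (\<lambda>l. \<alpha> l - (\<Sum>j\<in>I. \<alpha> j * cartan_entry q i j) * unit_vec i l)"

lemma refl_map_unit_vec:
  assumes "finite I" "j \<in> I"
  shows "refl_map I q i (unit_vec j) = (\<lambda>l. unit_vec j l - cartan_entry q i j * unit_vec i l)"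
proof -
  have "(\<Sum>l\<in>I. unit_vec j l * cartan_entry q i l) =
          (\<Sum>l\<in>I. if l = j then cartan_entry q i j else 0)"
    by (intro sum.cong) (auto simp: unit_vec_def)
  then show ?thesis
    using assms by (simp add: refl_map_def)
qed

definition reflection :: "'i set \<Rightarrow> 'i \<Rightarrow> ('i \<Rightarrow> 'i \<Rightarrow> 'k::field) \<Rightarrow> 'i \<Rightarrow> 'i \<Rightarrow> 'k" where
  "reflection I i q =
     (\<lambda>j l. bichar I q (refl_map I q i (unit_vec j)) (refl_map I q i (unit_vec l)))"

definition diagonal_ne_1 :: "'i set \<Rightarrow> ('i \<Rightarrow> 'i \<Rightarrow> 'k::field) \<Rightarrow> bool" where
  "diagonal_ne_1 I q \<longleftrightarrow> (\<forall>i\<in>I. q i i \<noteq> 1)"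

text \<open>
  The matrices obtained from \<open>q\<close> by finitely many reflections. A matrix is only reflected if all
  its diagonal entries differ from \<open>1\<close>, since otherwise its reflections are not defined.
\<close>

inductive reflection_sequence ::
    "'i set \<Rightarrow> ('i \<Rightarrow> 'i \<Rightarrow> 'k::field) \<Rightarrow> ('i \<Rightarrow> 'i \<Rightarrow> 'k) \<Rightarrow> bool"
  for I :: "'i set" and q :: "'i \<Rightarrow> 'i \<Rightarrow> 'k" where
  start: "reflection_sequence I q q"
| reflect: "reflection_sequence I q q' \<Longrightarrow> diagonal_ne_1 I q' \<Longrightarrow> i \<in> I \<Longrightarrow>
            reflection_sequence I q (reflection I i q')"

definition weyl_groupoid_defined :: "'i set \<Rightarrow> ('i \<Rightarrow> 'i \<Rightarrow> 'k::field) \<Rightarrow> bool" where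
  "weyl_groupoid_defined I q \<longleftrightarrow> (\<forall>q'. reflection_sequence I q q' \<longrightarrow> diagonal_ne_1 I q')"

end

theory Submission
  imports Defs
begin

text \<open>
  The matrix \<open>q\<^sub>i\<^sub>j = \<xi>\<^sup>i\<close> has rank one in the exponent: \<open>q\<^sub>i\<^sub>j = \<xi> powi (w\<^sub>i * h\<^sub>j)\<close> with
  \<open>w\<^sub>i = i\<close> and \<open>h\<^sub>j = 1\<close>. Hence the bicharacter is \<open>\<chi>(\<alpha>, \<beta>) = \<xi> powi (w(\<alpha>) * h(\<beta>))\<close> for two
  linear forms \<open>w\<close>, \<open>h\<close>, every reflected matrix has the same shape, and a reflection at \<open>i\<close>
  replaces each pair \<open>(w\<^sub>a, h\<^sub>a)\<close> by \<open>(w\<^sub>a, h\<^sub>a) - a\<^sub>i\<^sub>a (w\<^sub>i, h\<^sub>i)\<close>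
  (\<open>reflection_exponent_weights\<close>). The task is to reach a pair with \<open>n dvd w\<^sub>a * h\<^sub>a\<close>.

  Since \<open>p\<close> divides \<open>2 * r - 1\<close>, it does not divide \<open>r\<close>, and \<open>r \<ge> 2\<close>. Write \<open>n = p * r * s\<close>.
  For \<open>r \<ge> 3\<close> take \<open>i = p * s\<close>, \<open>j = (r - 1) * p * s\<close> and \<open>k = r * s\<close>. Both \<open>q\<^sub>i\<^sub>i\<close> and \<open>q\<^sub>j\<^sub>j\<close>
  have order \<open>r\<close>, and \<open>i + j = n\<close> makes \<open>a\<^sub>i\<^sub>j = 0\<close>, so that the reflection at \<open>i\<close> does not change
  the pair of \<open>j\<close>. As \<open>k\<close> is not a multiple of \<open>p * s\<close>, the condition on \<open>q\<^sub>i\<^sub>i\<^sup>m q\<^sub>i\<^sub>k q\<^sub>k\<^sub>i\<close> can never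
  hold, and the Cartan entry is decided by the order of \<open>q\<^sub>i\<^sub>i\<close> alone: \<open>a\<^sub>i\<^sub>k = 1 - r\<close>. The same
  holds for \<open>j\<close> after the first reflection (\<open>cartan_entry_determined_by_order\<close>). Reflecting at
  \<open>i\<close> and then at \<open>j\<close> therefore adds \<open>r - 1\<close> times both \<open>(i, 1)\<close> and \<open>(j, 1)\<close> to \<open>(k, 1)\<close>. The result
  is \<open>(k + (r - 1) * n, 2 * r - 1)\<close>, and \<open>n\<close> divides the product of its entries because
  \<open>p * r * s\<close> divides \<open>(2 * r - 1) * r * s\<close>.

  For \<open>r = 2\<close> these vertices \<open>i\<close> and \<open>j\<close> coincide. In that case \<open>p = 3\<close> and \<open>n = 6 * s\<close>, and the
  reflections at \<open>2 * s\<close> and then at \<open>s\<close> lead to the pair \<open>(3 * s, 2)\<close> at the vertex \<open>2 * s\<close>.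
\<close>

section \<open>Powers of a primitive root of unity\<close>

lemma primitive_root_of_unity_nonzero:
  "primitive_root_of_unity n \<xi> \<Longrightarrow> \<xi> \<noteq> 0"
  by (auto simp: primitive_root_of_unity_def power_0_left split: if_splits)

lemma primitive_root_powi_eq_1_iff:
  assumes "primitive_root_of_unity n \<xi>"
  shows "\<xi> powi z = 1 \<longleftrightarrow> int n dvd z"
proof -
  have n: "n > 0" and one: "\<xi> ^ n = 1"
    and least: "\<And>m. 0 < m \<Longrightarrow> m < n \<Longrightarrow> \<xi> ^ m \<noteq> 1"
    using assms by (auto simp: primitive_root_of_unity_def)
  have nz: "\<xi> \<noteq> 0"
    using assms by (rule primitive_root_of_unity_nonzero)
  define m where "m = nat (z mod int n)"
  have m: "int m = z mod int n" "m < n"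
    using n by (auto simp: m_def nat_less_iff)
  have "\<xi> powi z = \<xi> powi (int n * (z div int n) + int m)"
    by (simp add: m(1))
  also have "\<dots> = \<xi> ^ m"
    using nz one by (simp add: power_int_add power_int_mult)
  finally have "\<xi> powi z = 1 \<longleftrightarrow> m = 0"
    using least[of m] m(2) by auto
  also have "\<dots> \<longleftrightarrow> int n dvd z"
    by (simp add: dvd_eq_mod_eq_0 flip: m(1))
  finally show ?thesis .
qed

lemma q_int_eq_0_iff:
  assumes "x \<noteq> 1"
  shows "q_int m x = 0 \<longleftrightarrow> x ^ m = 1"
  using assms by (simp add: q_int_def sum_gp_strict)

lemma power_int_sum:
  fixes x :: "'a::field"
  assumes "x \<noteq> 0"
  shows "x powi (\<Sum>i\<in>A. f i) = (\<Prod>i\<in>A. x powi f i)"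
  using assms by (induction A rule: infinite_finite_induct) (auto simp: power_int_add)

section \<open>Reflections of matrices with factored exponents\<close>

definition exponent_weights ::
    "'i set \<Rightarrow> 'k::field \<Rightarrow> ('i \<Rightarrow> int) \<Rightarrow> ('i \<Rightarrow> int) \<Rightarrow> ('i \<Rightarrow> 'i \<Rightarrow> 'k) \<Rightarrow> bool" where
  "exponent_weights I \<xi> w h q \<longleftrightarrow> (\<forall>a\<in>I. \<forall>b\<in>I. q a b = \<xi> powi (w a * h b))"

lemma bichar_exponent_weights:
  assumes "\<xi> \<noteq> 0" and "exponent_weights I \<xi> w h q"
  shows "bichar I q \<alpha> \<beta> = \<xi> powi ((\<Sum>a\<in>I. \<alpha> a * w a) * (\<Sum>b\<in>I. \<beta> b * h b))"
proof -
  have "bichar I q \<alpha> \<beta> = (\<Prod>a\<in>I. \<Prod>b\<in>I. \<xi> powi ((\<alpha> a * w a) * (\<beta> b * h b)))"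
    using assms(2) unfolding bichar_def exponent_weights_def
    by (intro prod.cong) (auto simp: mult_ac simp flip: power_int_mult)
  also have "\<dots> = \<xi> powi (\<Sum>a\<in>I. \<Sum>b\<in>I. (\<alpha> a * w a) * (\<beta> b * h b))"
    using assms(1) by (simp add: power_int_sum)
  finally show ?thesis
    by (simp add: sum_product)
qed

text \<open>
  The shape survives because both linear forms are pulled back along the same map \<open>\<sigma>\<^sub>i\<close>. With
  \<open>a\<^sub>i\<^sub>i = 2\<close> the formula also covers the vertex \<open>i\<close>, whose pair changes sign.
\<close>
lemma reflection_exponent_weights:
  assumes "finite I" "i \<in> I" "\<xi> \<noteq> 0" and q: "exponent_weights I \<xi> w h q"
  shows "exponent_weights I \<xi>
           (\<lambda>a. w a - cartan_entry q i a * w i) (\<lambda>a. h a - cartan_entry q i a * h i)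
           (reflection I i q)"
proof -
  have unit: "(\<Sum>l\<in>I. unit_vec b l * f l) = f b" if "b \<in> I" for b and f :: "'a \<Rightarrow> int"
  proof -
    have "(\<Sum>l\<in>I. unit_vec b l * f l) = (\<Sum>l\<in>I. if l = b then f b else 0)"
      by (intro sum.cong) (auto simp: unit_vec_def)
    then show ?thesis
      using that assms(1) by simp
  qed
  have "(\<Sum>l\<in>I. refl_map I q i (unit_vec b) l * f l) = f b - cartan_entry q i b * f i"
    if "b \<in> I" for b and f :: "'a \<Rightarrow> int"
    using that assms(1,2)
    by (simp add: refl_map_unit_vec left_diff_distrib sum_subtractf unit mult.assoc
          flip: sum_distrib_left)
  then show ?thesis
    by (simp add: exponent_weights_def reflection_def bichar_exponent_weights[OF assms(3) q])
qed

text \<open>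
  The order \<open>r\<close> of \<open>q\<^sub>i\<^sub>i\<close> is an upper bound for \<open>1 - a\<^sub>i\<^sub>j\<close>. It is attained when the other
  condition \<open>q\<^sub>i\<^sub>i\<^sup>m q\<^sub>i\<^sub>j q\<^sub>j\<^sub>i = 1\<close> has no solution, which is guaranteed here by \<open>d\<close>: it divides \<open>n\<close>
  and the exponent of \<open>q\<^sub>i\<^sub>i\<close>, but not the exponent of \<open>q\<^sub>i\<^sub>j q\<^sub>j\<^sub>i\<close>.
\<close>
lemma cartan_entry_determined_by_order:
  assumes \<xi>: "primitive_root_of_unity n \<xi>"
    and q: "exponent_weights I \<xi> w h q"
    and ij: "i \<in> I" "j \<in> I" "i \<noteq> j"
    and n: "int n = int r * d" and r: "r \<ge> 2"
    and u: "w i * h i = d * c" and c: "coprime c (int r)"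
    and v: "\<not> d dvd w i * h j + w j * h i"
  shows "cartan_entry q i j = 1 - int r"
proof -
  note [simp] = primitive_root_powi_eq_1_iff[OF \<xi>]
  have nz: "\<xi> \<noteq> 0"
    using \<xi> by (rule primitive_root_of_unity_nonzero)
  have d: "d \<noteq> 0"
    using n \<xi> by (auto simp: primitive_root_of_unity_def)
  have qs: "q i i = \<xi> powi (d * c)" "q i j = \<xi> powi (w i * h j)" "q j i = \<xi> powi (w j * h i)"
    using q ij by (auto simp: exponent_weights_def simp flip: u)
  have pow: "q i i ^ m = \<xi> powi (d * c * int m)" for m
    using power_int_mult[of \<xi> "d * c" "int m"] by (simp add: qs)
  have order: "q i i ^ m = 1 \<longleftrightarrow> r dvd m" for m
  proof -
    have "q i i ^ m = 1 \<longleftrightarrow> d * int r dvd d * (c * int m)"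
      by (simp add: pow n mult_ac)
    also have "\<dots> \<longleftrightarrow> int r dvd int m"
      using d c by (simp add: coprime_commute coprime_dvd_mult_right_iff)
    finally show ?thesis by simp
  qed
  have ne1: "q i i \<noteq> 1"
    using order[of 1] r by simp
  have no_string: "q i i ^ m * q i j * q j i \<noteq> 1" for m
  proof
    assume *: "q i i ^ m * q i j * q j i = 1"
    have "q i i ^ m * q i j * q j i =
            \<xi> powi (d * (c * int m) + (w i * h j + w j * h i))"
      using nz by (simp only: pow) (simp add: qs power_int_add mult_ac)
    with * have "int n dvd d * (c * int m) + (w i * h j + w j * h i)"
      by simp
    then have "d dvd d * (c * int m) + (w i * h j + w j * h i)"
      by (rule dvd_trans[rotated]) (simp add: n)
    with v show False
      by (simp add: dvd_add_right_iff)
  qed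
  have "(LEAST m. q_int (m + 1) (q i i) * (q i i ^ m * q i j * q j i - 1) = 0)
          = (LEAST m. r dvd m + 1)"
    using no_string by (simp only: mult_eq_0_iff q_int_eq_0_iff[OF ne1] order) simp
  also have "\<dots> = r - 1"
    using r by (intro Least_equality) (auto dest!: dvd_imp_le)
  finally show ?thesis
    using ij(3) r by (simp add: cartan_entry_def of_nat_diff)
qed

lemma cartan_entry_eq_0:
  assumes "i \<noteq> j" "q i j * q j i = 1"
  shows "cartan_entry q i j = 0"
  using assms by (simp add: cartan_entry_def Least_eq_0)

text \<open>
  If the groupoid were defined, all intermediate matrices would satisfy the diagonal condition
  that licenses the next reflection. A refutation therefore has to compute only the last
  diagonal entry.
\<close>
lemma not_weyl_groupoid_definedI:
  assumes "i \<in> I" "j \<in> I" "k \<in> I" "reflection I j (reflection I i q) k k = 1"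
  shows "\<not> weyl_groupoid_defined I q"
proof
  assume "weyl_groupoid_defined I q"
  then have D: "diagonal_ne_1 I q'" if "reflection_sequence I q q'" for q'
    using that by (auto simp: weyl_groupoid_defined_def)
  have "reflection_sequence I q (reflection I j (reflection I i q))"
    using assms(1,2) by (intro reflection_sequence.intros D) auto
  from D[OF this] show False
    using assms(3,4) by (auto simp: diagonal_ne_1_def)
qed

section \<open>The braiding of the cyclic group\<close>

theorem lemma2p5:
  fixes n r p :: nat
    and \<xi> :: "'k::field_char_0"
    and q :: "nat \<Rightarrow> nat \<Rightarrow> 'k"
  assumes "n \<ge> 2"
    and "primitive_root_of_unity n \<xi>"
    and "diagonal_type {1..<n} (cyclic_braiding n \<xi>) q"
    and "r > 0"
    and "prime p"
    and "p dvd 2 * r - 1"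
    and "p * r dvd n"
  shows "\<not> weyl_groupoid_defined {1..<n} q"
proof -
  let ?I = "{1..<n}"
  note root = assms(2)
  have nz: "\<xi> \<noteq> 0"
    using root by (rule primitive_root_of_unity_nonzero)
  have q: "exponent_weights ?I \<xi> int (\<lambda>_. 1) q"
    using assms(3) unfolding diagonal_type_cyclic_braiding_iff exponent_weights_def by simp
  obtain s where n: "n = p * r * s"
    using assms(7) by (auto elim: dvdE)
  have s: "s > 0"
    using n assms(1) by (cases s) auto
  have p1: "p > 1"
    using assms(5) by (rule prime_gt_1_nat)
  have p_r: "\<not> p dvd r"
  proof
    assume "p dvd r"
    then have "p dvd 2 * r - (2 * r - 1)"
      by (intro dvd_diff_nat dvd_mult assms(6))
    also have "2 * r - (2 * r - 1) = 1"
      using assms(4) by simp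
    finally show False
      using p1 by simp
  qed
  have r2: "r \<ge> 2"
    using assms(4,6) p1 by (cases "r = 1") auto
  show ?thesis
  proof (cases "r = 2")
    case True
    have "p = 3"
      using assms(5,6) by (intro primes_dvd_imp_eq) (simp_all add: True)
    with n True have n6: "n = 6 * s" by simp
    let ?i = "2 * s" and ?j = s
    have I: "?i \<in> ?I" "?j \<in> ?I" and ne: "?i \<noteq> ?j"
      using s n6 by auto
    \<comment> \<open>\<open>q\<^sub>i\<^sub>i\<close> has order 3, and \<open>q\<^sub>i\<^sub>j q\<^sub>j\<^sub>i\<close> has exponent \<open>3 * s\<close>.\<close>
    have "\<not> 2 * int s dvd 3 * int s"
      using s by simp
    then have "cartan_entry q ?i ?j = 1 - int 3"
      using n6 by (intro cartan_entry_determined_by_order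
          [OF root q I ne, where d = "2 * int s" and c = 1]) auto
    then have ij: "cartan_entry q ?i ?j = -2" by simp
    define q1 where "q1 = reflection ?I ?i q"
    define w1 where "w1 = (\<lambda>a. int a - cartan_entry q ?i a * int ?i)"
    define h1 where "h1 = (\<lambda>a. 1 - cartan_entry q ?i a * 1)"
    have q1: "exponent_weights ?I \<xi> w1 h1 q1"
      unfolding q1_def w1_def h1_def
      by (rule reflection_exponent_weights[OF _ I(1) nz q]) simp
    have ii: "cartan_entry q ?i ?i = 2"
      by (simp add: cartan_entry_def)
    have wh1: "w1 ?j = 5 * int s" "h1 ?j = 3" "w1 ?i = -2 * int s" "h1 ?i = -1"
      by (simp_all add: w1_def h1_def ij ii)
    \<comment> \<open>The new \<open>q\<^sub>j\<^sub>j\<close> has exponent \<open>15 * s = 3 * s * 5\<close> and hence order 2.\<close>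
    have "cartan_entry q1 ?j ?i = 1 - int 2"
    proof (rule cartan_entry_determined_by_order
        [OF root q1 I(2,1) ne[symmetric], where d = "3 * int s" and c = 5])
      have "w1 ?j * h1 ?i + w1 ?i * h1 ?j = - (11 * int s)"
        by (simp add: wh1)
      then show "\<not> 3 * int s dvd w1 ?j * h1 ?i + w1 ?i * h1 ?j"
        using s by simp
    qed (simp_all add: n6 wh1)
    then have ji: "cartan_entry q1 ?j ?i = -1" by simp
    have "reflection ?I ?j q1 ?i ?i = \<xi> powi (3 * int s * 2)"
      using reflection_exponent_weights[OF _ I(2) nz q1] I(1)
      by (simp add: exponent_weights_def wh1 ji)
    also have "\<dots> = 1"
      by (simp add: primitive_root_powi_eq_1_iff[OF root] n6)
    finally show ?thesis
      unfolding q1_def by (rule not_weyl_groupoid_definedI[OF I(1,2,1)])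
  next
    case False
    with r2 have r3: "r \<ge> 3" by simp
    let ?i = "p * s" and ?j = "(r - 1) * p * s" and ?k = "r * s"
    \<comment> \<open>The exponents of \<open>q\<^sub>i\<^sub>i\<close> and \<open>q\<^sub>j\<^sub>j\<close> are multiples of \<open>d\<close>; \<open>k\<close> is not, and this
      separates the two conditions in the definition of \<open>a\<^sub>i\<^sub>k\<close> and \<open>a\<^sub>j\<^sub>k\<close>.\<close>
    define d where "d = int p * int s"
    have nd: "int n = int r * d"
      by (simp add: n d_def)
    have ps0: "p * s > 0"
      using s p1 by simp
    have i_j: "?i + ?j = n"
      using r3 by (cases r) (auto simp: n algebra_simps)
    have j0: "?j > ?i"
      using r3 ps0 mult_less_mono1[of 1 "r - 1" "p * s"] by (simp add: mult.assoc)
    have "1 * (r * s) < p * (r * s)"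
      using p1 s assms(4) by (intro mult_less_mono1) auto
    then have I: "?i \<in> ?I" "?j \<in> ?I" "?k \<in> ?I"
      using i_j j0 ps0 s assms(4) by (auto simp: n mult.assoc)
    have i_ne_j: "?i \<noteq> ?j"
      using j0 by simp
    have d_k: "\<not> d dvd int ?k"
      using p_r s by (simp add: d_def)
    have d_j: "int ?j = d * (int r - 1)"
      using assms(4) by (simp add: d_def of_nat_diff)
    have i_ne_k: "?i \<noteq> ?k" and j_ne_k: "?j \<noteq> ?k"
    proof -
      have "d dvd int ?i" "d dvd int ?j"
        by (simp add: d_def) (simp only: d_j dvd_triv_left)
      with d_k show "?i \<noteq> ?k" "?j \<noteq> ?k" by metis+
    qed
    have cop: "coprime (int r - 1) (int r)"
      by (rule coprime_diff_one_left)
    have "\<xi> ^ ?i * \<xi> ^ ?j = 1"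
      using root unfolding power_add[symmetric] i_j by (simp add: primitive_root_of_unity_def)
    then have ij: "cartan_entry q ?i ?j = 0"
      using q I i_ne_j by (intro cartan_entry_eq_0) (auto simp: exponent_weights_def)
    have ik: "cartan_entry q ?i ?k = 1 - int r"
    proof (rule cartan_entry_determined_by_order
        [OF root q I(1,3) i_ne_k nd r2, where c = 1])
      show "\<not> d dvd int ?i * 1 + int ?k * 1"
        using d_k by (simp add: d_def)
    qed (auto simp: d_def)
    define q1 where "q1 = reflection ?I ?i q"
    define w1 where "w1 = (\<lambda>a. int a - cartan_entry q ?i a * int ?i)"
    define h1 where "h1 = (\<lambda>a. 1 - cartan_entry q ?i a * 1)"
    have q1: "exponent_weights ?I \<xi> w1 h1 q1"
      unfolding q1_def w1_def h1_def
      by (rule reflection_exponent_weights[OF _ I(1) nz q]) simp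
    have wh1: "w1 ?j = d * (int r - 1)" "h1 ?j = 1"
      "w1 ?k = int ?k + d * (int r - 1)" "h1 ?k = int r"
      by (simp_all only: w1_def h1_def ij ik d_j) (auto simp: d_def algebra_simps)
    have jk: "cartan_entry q1 ?j ?k = 1 - int r"
    proof (rule cartan_entry_determined_by_order
        [OF root q1 I(2,3) j_ne_k nd r2 _ cop])
      show "\<not> d dvd w1 ?j * h1 ?k + w1 ?k * h1 ?j"
      proof
        assume "d dvd w1 ?j * h1 ?k + w1 ?k * h1 ?j"
        then have "d dvd d * ((int r - 1) * int r + (int r - 1)) + int ?k"
          by (simp only: wh1) (simp add: algebra_simps)
        with d_k show False
          by (simp only: dvd_add_right_iff[OF dvd_triv_left])
      qed
    qed (simp only: wh1 mult_1_right)
    obtain t where t: "2 * int r - 1 = int p * t"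
    proof -
      have "int p dvd int (2 * r - 1)"
        using assms(6) by (simp only: of_nat_dvd_iff)
      then show ?thesis
        using assms(4) that by (simp add: of_nat_diff dvd_def) blast
    qed
    have "reflection ?I ?j q1 ?k ?k =
            \<xi> powi ((w1 ?k - cartan_entry q1 ?j ?k * w1 ?j) *
                    (h1 ?k - cartan_entry q1 ?j ?k * h1 ?j))"
      using reflection_exponent_weights[OF _ I(2) nz q1] I(3)
      by (simp add: exponent_weights_def)
    also have "(w1 ?k - cartan_entry q1 ?j ?k * w1 ?j) *
                 (h1 ?k - cartan_entry q1 ?j ?k * h1 ?j)
               = (int ?k + (int r - 1) * int n) * (2 * int r - 1)"
      by (simp only: wh1 jk nd) (simp add: algebra_simps)
    \<comment> \<open>Here \<open>p\<close> divides \<open>2 * r - 1\<close>, which supplies the factor of \<open>n\<close> that \<open>k = r * s\<close> lacks.\<close>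
    also have "\<dots> = int n * (t + (int r - 1) * (2 * int r - 1))"
      by (simp only: distrib_right t) (simp add: n algebra_simps)
    also have "\<xi> powi \<dots> = 1"
      by (simp add: primitive_root_powi_eq_1_iff[OF root])
    finally show ?thesis
      unfolding q1_def by (rule not_weyl_groupoid_definedI[OF I])
  qed
qed

end
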